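(* Let $M$ be a non-zero left $R$-module. Then $\mathbf{Z}^{\mathrm{fc}}_{\mathrm{f.i.}}(M):=(\mathrm{Spec}^{\mathrm{fc}}(M),\tau^{\mathrm{fc}}_{\mathrm{f.i.}}(M))$ is a topological space, i.e. $\tau^{\mathrm{fc}}_{\mathrm{f.i.}}(M)$ is the family of open sets of a topology on $\mathrm{Spec}^{\mathrm{fc}}(M)$. In particular, if $M$ is duo, then $M$ is a top$^{\mathrm{fc}}$-module and $\mathbf{Z}^{\mathrm{fc}}(M):=(\mathrm{Spec}^{\mathrm{fc}}(M),\tau^{\mathrm{fc}}(M))$ is a topological space.
   Context: $R$ is an associative (not necessarily commutative) ring with $1_R\neq 0_R$ and modules are unital left $R$-modules; $L\leq_R M$ means that $L$ is an $R$-submodule of $M$. A submodule $L\leq_R M$ is fully invariant if $f(L)\subseteq L$ for every $R$-linear endomorphism $f$ of $M$; $M$ is duo if every $R$-submodule of $M$ is fully invariant. For $X,Y\leq_R M$ put $\mathrm{An}(X)=\{f\in \mathrm{End}_R(M)\mid f(X)=0\}$ and $X\odot_M Y=\bigcap_{f\in\mathrm{An}(X)} f^{-1}(Y)$. A non-zero fully invariant submodule $K$ of $M$ is fully coprime in $M$ if for all fully invariant submodules $X,Y$ of $M$: $K\subseteq X\odot_M Y$ implies $K\subseteq X$ or $K\subseteq Y$. $\mathrm{Spec}^{\mathrm{fc}}(M)$ is the (possibly empty) set of all non-zero fully invariant submodules of $M$ that are fully coprime in $M$. For $L\leq_R M$ put $\mathcal{V}^{\mathrm{fc}}(L)=\{K\in\mathrm{Spec}^{\mathrm{fc}}(M)\mid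 K\subseteq L\}$ and $\mathcal{X}^{\mathrm{fc}}(L)=\{K\in\mathrm{Spec}^{\mathrm{fc}}(M)\mid K\not\subseteq L\}$. Put $\xi^{\mathrm{fc}}(M)=\{\mathcal{V}^{\mathrm{fc}}(L)\mid L\leq_R M\}$, $\tau^{\mathrm{fc}}(M)=\{\mathcal{X}^{\mathrm{fc}}(L)\mid L\leq_R M\}$ and $\tau^{\mathrm{fc}}_{\mathrm{f.i.}}(M)=\{\mathcal{X}^{\mathrm{fc}}(L)\mid L\leq_R M \text{ fully invariant}\}$. $M$ is a top$^{\mathrm{fc}}$-module if $\xi^{\mathrm{fc}}(M)$ is closed under finite unions. *)

theory Defs
  imports "HOL-Algebra.Module" "HOL-Analysis.Abstract_Topology"
begin

text \<open>
  The locale \<open>module\<close> of HOL-Algebra requires a commutative ring of scalars, so unital left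
  modules over an arbitrary ring get their own locale, with the same axioms. Its record type and
  its locale \<open>submodule\<close> do not depend on commutativity and are used as they are.
\<close>

locale left_module = R?: ring R + M?: abelian_group M
  for R :: "('a, 'r) ring_scheme" (structure) and M :: "('a, 'b, 'm) module_scheme" (structure) +
  assumes smult_closed:
      "\<lbrakk>a \<in> carrier R; x \<in> carrier M\<rbrakk> \<Longrightarrow> a \<odot>\<^bsub>M\<^esub> x \<in> carrier M"
    and smult_l_distr:
      "\<lbrakk>a \<in> carrier R; b \<in> carrier R; x \<in> carrier M\<rbrakk> \<Longrightarrow>
        (a \<oplus>\<^bsub>R\<^esub> b) \<odot>\<^bsub>M\<^esub> x = (a \<odot>\<^bsub>M\<^esub> x) \<oplus>\<^bsub>M\<^esub> (b \<odot>\<^bsub>M\<^esub> x)"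
    and smult_r_distr:
      "\<lbrakk>a \<in> carrier R; x \<in> carrier M; y \<in> carrier M\<rbrakk> \<Longrightarrow>
        a \<odot>\<^bsub>M\<^esub> (x \<oplus>\<^bsub>M\<^esub> y) = (a \<odot>\<^bsub>M\<^esub> x) \<oplus>\<^bsub>M\<^esub> (a \<odot>\<^bsub>M\<^esub> y)"
    and smult_assoc:
      "\<lbrakk>a \<in> carrier R; b \<in> carrier R; x \<in> carrier M\<rbrakk> \<Longrightarrow>
        (a \<otimes>\<^bsub>R\<^esub> b) \<odot>\<^bsub>M\<^esub> x = a \<odot>\<^bsub>M\<^esub> (b \<odot>\<^bsub>M\<^esub> x)"
    and smult_one:
      "x \<in> carrier M \<Longrightarrow> \<one>\<^bsub>R\<^esub> \<odot>\<^bsub>M\<^esub> x = x"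

text \<open>
  Endomorphisms are taken extensional, so that each one is represented by exactly one function.
\<close>

definition module_End :: "('a, 'r) ring_scheme \<Rightarrow> ('a, 'b, 'm) module_scheme \<Rightarrow> ('b \<Rightarrow> 'b) set" where
  "module_End R M =
    {f \<in> hom (add_monoid M) (add_monoid M) \<inter> extensional (carrier M).
      \<forall>a \<in> carrier R. \<forall>x \<in> carrier M. f (a \<odot>\<^bsub>M\<^esub> x) = a \<odot>\<^bsub>M\<^esub> f x}"

definition fully_invariant ::
    "('a, 'r) ring_scheme \<Rightarrow> ('a, 'b, 'm) module_scheme \<Rightarrow> 'b set \<Rightarrow> bool" where
  "fully_invariant R M L \<longleftrightarrow> submodule L R M \<and> (\<forall>f \<in> module_End R M. f ` L \<subseteq> L)"

definition duo_module :: "('a, 'r) ring_scheme \<Rightarrow> ('a, 'b, 'm) module_scheme \<Rightarrow> bool" where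
  "duo_module R M \<longleftrightarrow> (\<forall>L. submodule L R M \<longrightarrow> fully_invariant R M L)"

definition An :: "('a, 'r) ring_scheme \<Rightarrow> ('a, 'b, 'm) module_scheme \<Rightarrow> 'b set \<Rightarrow> ('b \<Rightarrow> 'b) set" where
  "An R M X = {f \<in> module_End R M. f ` X = {\<zero>\<^bsub>M\<^esub>}}"

definition internal_coproduct ::
    "('a, 'r) ring_scheme \<Rightarrow> ('a, 'b, 'm) module_scheme \<Rightarrow> 'b set \<Rightarrow> 'b set \<Rightarrow> 'b set" where
  "internal_coproduct R M X Y = (\<Inter>f \<in> An R M X. {x \<in> carrier M. f x \<in> Y})"

definition fully_coprime ::
    "('a, 'r) ring_scheme \<Rightarrow> ('a, 'b, 'm) module_scheme \<Rightarrow> 'b set \<Rightarrow> bool" where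
  "fully_coprime R M K \<longleftrightarrow>
    fully_invariant R M K \<and> K \<noteq> {\<zero>\<^bsub>M\<^esub>} \<and>
    (\<forall>X Y. fully_invariant R M X \<longrightarrow> fully_invariant R M Y \<longrightarrow>
      K \<subseteq> internal_coproduct R M X Y \<longrightarrow> K \<subseteq> X \<or> K \<subseteq> Y)"

definition Spec_fc :: "('a, 'r) ring_scheme \<Rightarrow> ('a, 'b, 'm) module_scheme \<Rightarrow> 'b set set" where
  "Spec_fc R M = {K. fully_coprime R M K}"

definition V_fc ::
    "('a, 'r) ring_scheme \<Rightarrow> ('a, 'b, 'm) module_scheme \<Rightarrow> 'b set \<Rightarrow> 'b set set" where
  "V_fc R M L = {K \<in> Spec_fc R M. K \<subseteq> L}"

definition X_fc ::
    "('a, 'r) ring_scheme \<Rightarrow> ('a, 'b, 'm) module_scheme \<Rightarrow> 'b set \<Rightarrow> 'b set set" where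
  "X_fc R M L = {K \<in> Spec_fc R M. \<not> K \<subseteq> L}"

definition xi_fc :: "('a, 'r) ring_scheme \<Rightarrow> ('a, 'b, 'm) module_scheme \<Rightarrow> 'b set set set" where
  "xi_fc R M = {V_fc R M L | L. submodule L R M}"

definition tau_fc :: "('a, 'r) ring_scheme \<Rightarrow> ('a, 'b, 'm) module_scheme \<Rightarrow> 'b set set set" where
  "tau_fc R M = {X_fc R M L | L. submodule L R M}"

definition tau_fc_fi :: "('a, 'r) ring_scheme \<Rightarrow> ('a, 'b, 'm) module_scheme \<Rightarrow> 'b set set set" where
  "tau_fc_fi R M = {X_fc R M L | L. fully_invariant R M L}"

text \<open>
  The empty union is included; it is always in \<^term>\<open>xi_fc R M\<close>, being \<open>V_fc R M\<close> of the zero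
  submodule.
\<close>

definition top_fc_module :: "('a, 'r) ring_scheme \<Rightarrow> ('a, 'b, 'm) module_scheme \<Rightarrow> bool" where
  "top_fc_module R M \<longleftrightarrow> (\<forall>F. finite F \<longrightarrow> F \<subseteq> xi_fc R M \<longrightarrow> \<Union>F \<in> xi_fc R M)"

text \<open>
  In terms of \<^const>\<open>istopology\<close> alone the underlying set is implicit, namely the union of all
  open sets; hence the second conjunct.
\<close>

definition topology_on_set :: "'p set \<Rightarrow> 'p set set \<Rightarrow> bool" where
  "topology_on_set S \<tau> \<longleftrightarrow>
    istopology (\<lambda>U. U \<in> \<tau>) \<and> topspace (topology (\<lambda>U. U \<in> \<tau>)) = S"

end

theory Submission
  imports Defs
begin

text \<open>
  The sets \<open>V_fc R M L\<close> with \<open>L\<close> fully invariant behave like the closed sets of a Zariski topology.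
  Arbitrary intersections cause no difficulty: \<open>K\<close> lies in every \<open>L \<in> \<A>\<close> if and only if it lies in
  \<open>\<Inter>\<A>\<close>, and an intersection of fully invariant submodules is fully invariant
  (\<open>fully_invariant_Inter\<close>).

  The point is closure under binary unions, and this is where coprimeness enters. For fully
  invariant \<open>X\<close> and \<open>Y\<close> the internal coproduct \<open>X \<odot>\<^sub>M Y\<close> is again fully invariant
  (\<open>fully_invariant_internal_coproduct\<close>) and contains both \<open>X\<close> and \<open>Y\<close>. Hence a coprime
  \<open>K\<close> contained in \<open>X\<close> or in \<open>Y\<close> is contained in \<open>X \<odot>\<^sub>M Y\<close>, and the defining property of
  coprimeness is exactly the converse. So \<open>V_fc R M X \<union> V_fc R M Y = V_fc R M (X \<odot>\<^sub>M Y)\<close>,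
  or dually \<open>X_fc R M X \<inter> X_fc R M Y = X_fc R M (X \<odot>\<^sub>M Y)\<close>.

  The zero submodule gives the whole spectrum as an open set, because coprime submodules are
  non-zero. In a duo module all submodules are fully invariant, so both families of open sets
  agree and the same formula for unions shows that \<open>xi_fc R M\<close> is closed under finite unions.
\<close>

section \<open>Endomorphisms and submodules of a left module\<close>

context left_module
begin

lemma End_closed: "f \<in> module_End R M \<Longrightarrow> x \<in> carrier M \<Longrightarrow> f x \<in> carrier M"
  by (auto simp: module_End_def hom_def)

lemma End_add:
  "f \<in> module_End R M \<Longrightarrow> x \<in> carrier M \<Longrightarrow> y \<in> carrier M \<Longrightarrow> f (x \<oplus>\<^bsub>M\<^esub> y) = f x \<oplus>\<^bsub>M\<^esub> f y"
  by (auto simp: module_End_def hom_def)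

lemma End_smult:
  "f \<in> module_End R M \<Longrightarrow> a \<in> carrier R \<Longrightarrow> x \<in> carrier M \<Longrightarrow> f (a \<odot>\<^bsub>M\<^esub> x) = a \<odot>\<^bsub>M\<^esub> f x"
  by (auto simp: module_End_def)

lemma End_group_hom: "f \<in> module_End R M \<Longrightarrow> group_hom (add_monoid M) (add_monoid M) f"
  by (simp add: group_hom_def group_hom_axioms_def module_End_def M.a_group)

lemma End_zero: "f \<in> module_End R M \<Longrightarrow> f \<zero>\<^bsub>M\<^esub> = \<zero>\<^bsub>M\<^esub>"
  using group_hom.hom_one[OF End_group_hom] by simp

lemma End_minus:
  "f \<in> module_End R M \<Longrightarrow> x \<in> carrier M \<Longrightarrow> f (\<ominus>\<^bsub>M\<^esub> x) = \<ominus>\<^bsub>M\<^esub> f x"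
  using group_hom.hom_inv[OF End_group_hom] by (simp add: a_inv_def)

lemma End_compose:
  assumes "f \<in> module_End R M" "g \<in> module_End R M"
  shows "compose (carrier M) f g \<in> module_End R M"
  using assms
  by (auto simp: module_End_def hom_def Pi_iff compose_def smult_closed)

lemma submoduleI:
  assumes "H \<subseteq> carrier M" "\<zero>\<^bsub>M\<^esub> \<in> H" "\<And>x. x \<in> H \<Longrightarrow> \<ominus>\<^bsub>M\<^esub> x \<in> H"
    and "\<And>x y. x \<in> H \<Longrightarrow> y \<in> H \<Longrightarrow> x \<oplus>\<^bsub>M\<^esub> y \<in> H"
    and "\<And>a x. a \<in> carrier R \<Longrightarrow> x \<in> H \<Longrightarrow> a \<odot>\<^bsub>M\<^esub> x \<in> H"
  shows "submodule H R M"
  using assms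
  by (intro submodule.intro subgroup.intro) (simp_all add: a_inv_def submodule_axioms_def)

lemma submoduleD:
  assumes "submodule H R M"
  shows "H \<subseteq> carrier M" "\<zero>\<^bsub>M\<^esub> \<in> H" "x \<in> H \<Longrightarrow> \<ominus>\<^bsub>M\<^esub> x \<in> H"
    and "x \<in> H \<Longrightarrow> y \<in> H \<Longrightarrow> x \<oplus>\<^bsub>M\<^esub> y \<in> H"
    and "a \<in> carrier R \<Longrightarrow> x \<in> H \<Longrightarrow> a \<odot>\<^bsub>M\<^esub> x \<in> H"
proof -
  have H: "subgroup H (add_monoid M)" using assms by (simp add: submodule_def)
  show "H \<subseteq> carrier M" using subgroup.subset[OF H] by simp
  show "\<zero>\<^bsub>M\<^esub> \<in> H" using subgroup.one_closed[OF H] by simp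
  show "x \<in> H \<Longrightarrow> \<ominus>\<^bsub>M\<^esub> x \<in> H" using subgroup.m_inv_closed[OF H] by (simp add: a_inv_def)
  show "x \<in> H \<Longrightarrow> y \<in> H \<Longrightarrow> x \<oplus>\<^bsub>M\<^esub> y \<in> H" using subgroup.m_closed[OF H] by simp
  show "a \<in> carrier R \<Longrightarrow> x \<in> H \<Longrightarrow> a \<odot>\<^bsub>M\<^esub> x \<in> H"
    using submodule.smult_closed[OF assms] by simp
qed

lemma smult_zero: "a \<in> carrier R \<Longrightarrow> a \<odot>\<^bsub>M\<^esub> \<zero>\<^bsub>M\<^esub> = \<zero>\<^bsub>M\<^esub>"
  using smult_r_distr[of a "\<zero>\<^bsub>M\<^esub>" "\<zero>\<^bsub>M\<^esub>"]
  by (metis M.add.r_cancel_one' M.zero_closed M.l_zero smult_closed)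

section \<open>Fully invariant submodules\<close>

lemma fully_invariantD:
  assumes "fully_invariant R M L"
  shows "submodule L R M" and "f \<in> module_End R M \<Longrightarrow> x \<in> L \<Longrightarrow> f x \<in> L"
  using assms by (auto simp: fully_invariant_def)

lemma fully_invariant_zero: "fully_invariant R M {\<zero>\<^bsub>M\<^esub>}"
  unfolding fully_invariant_def
  by (auto intro!: submoduleI simp: smult_zero End_zero)

text \<open>
  Intersecting with \<open>carrier M\<close> makes the empty family yield \<open>M\<close> itself rather than the whole
  type.
\<close>

lemma fully_invariant_Inter:
  assumes "\<And>L. L \<in> \<A> \<Longrightarrow> fully_invariant R M L"
  shows "fully_invariant R M (carrier M \<inter> \<Inter>\<A>)"
  unfolding fully_invariant_def
  using assms
  by (auto intro!: submoduleI
      simp: submoduleD[OF fully_invariantD(1)] fully_invariantD(2) End_closed smult_closed)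

section \<open>The internal coproduct of fully invariant submodules\<close>

text \<open>
  The zero endomorphism annihilates \<open>X\<close>, so the intersection over \<open>An R M X\<close> has at least one
  member and does not degenerate to the whole type.
\<close>

lemma internal_coproduct_subset_carrier:
  assumes "submodule X R M"
  shows "internal_coproduct R M X Y \<subseteq> carrier M"
proof -
  have "restrict (\<lambda>x. \<zero>\<^bsub>M\<^esub>) (carrier M) \<in> An R M X"
    using submoduleD(1,2)[OF assms]
    by (auto simp: An_def module_End_def hom_def smult_closed smult_zero image_iff)
  then show ?thesis unfolding internal_coproduct_def by blast
qed

lemma mem_internal_coproduct_iff:
  assumes "submodule X R M"
  shows "x \<in> internal_coproduct R M X Y \<longleftrightarrow> x \<in> carrier M \<and> (\<forall>f \<in> An R M X. f x \<in> Y)"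
  using internal_coproduct_subset_carrier[OF assms, of Y]
  unfolding internal_coproduct_def by blast

text \<open>
  If \<open>f\<close> annihilates \<open>X\<close> and \<open>g\<close> is any endomorphism, then \<open>g\<close> maps \<open>X\<close> into itself, so
  \<open>f \<circ> g\<close> annihilates \<open>X\<close> as well. Applying this to an element of the coproduct shows that
  \<open>g\<close> maps the coproduct into itself.
\<close>

lemma fully_invariant_internal_coproduct:
  assumes X: "fully_invariant R M X" and Y: "submodule Y R M"
  shows "fully_invariant R M (internal_coproduct R M X Y)"
proof -
  note sX = fully_invariantD(1)[OF X]
  note mem = mem_internal_coproduct_iff[OF sX]
  have End: "f \<in> module_End R M" if "f \<in> An R M X" for f
    using that by (simp add: An_def)
  have "submodule (internal_coproduct R M X Y) R M"
    by (rule submoduleI)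
      (auto simp: mem End smult_closed End_zero End_minus End_add End_smult submoduleD[OF Y])
  moreover have "g x \<in> internal_coproduct R M X Y"
    if g: "g \<in> module_End R M" and x: "x \<in> internal_coproduct R M X Y" for g x
  proof -
    have xM: "x \<in> carrier M" using x by (simp add: mem)
    have "f (g x) \<in> Y" if f: "f \<in> An R M X" for f
    proof -
      have "f y = \<zero>\<^bsub>M\<^esub>" if "y \<in> X" for y
        using f that by (auto simp: An_def)
      then have "compose (carrier M) f g ` X = {\<zero>\<^bsub>M\<^esub>}"
        using submoduleD(1,2)[OF sX] fully_invariantD(2)[OF X g]
        by (force simp: compose_def)
      then have "compose (carrier M) f g \<in> An R M X"
        using End_compose[OF End[OF f] g] by (simp add: An_def)
      then have "compose (carrier M) f g x \<in> Y" using x by (simp add: mem)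
      then show ?thesis using xM by (simp add: compose_def)
    qed
    then show ?thesis using End_closed[OF g xM] by (simp add: mem)
  qed
  ultimately show ?thesis by (auto simp: fully_invariant_def)
qed

text \<open>
  An \<open>f\<close> annihilating \<open>X\<close> sends \<open>X\<close> to \<open>0 \<in> Y\<close>, and sends \<open>Y\<close> into \<open>Y\<close> because \<open>Y\<close> is fully
  invariant.
\<close>

lemma Un_subset_internal_coproduct:
  assumes X: "submodule X R M" and Y: "fully_invariant R M Y"
  shows "X \<union> Y \<subseteq> internal_coproduct R M X Y"
proof
  note sY = submoduleD[OF fully_invariantD(1)[OF Y]]
  fix x assume x: "x \<in> X \<union> Y"
  have "f x \<in> Y" if "f \<in> An R M X" for f
  proof -
    have "f \<in> module_End R M" "\<And>y. y \<in> X \<Longrightarrow> f y = \<zero>\<^bsub>M\<^esub>"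
      using that by (auto simp: An_def)
    then show ?thesis using x sY(2) fully_invariantD(2)[OF Y] by auto
  qed
  then show "x \<in> internal_coproduct R M X Y"
    using x sY(1) submoduleD(1)[OF X] by (auto simp: mem_internal_coproduct_iff[OF X])
qed

section \<open>The topology on the spectrum\<close>

lemma coprime_subset_internal_coproduct_iff:
  assumes "K \<in> Spec_fc R M" "fully_invariant R M X" "fully_invariant R M Y"
  shows "K \<subseteq> internal_coproduct R M X Y \<longleftrightarrow> K \<subseteq> X \<or> K \<subseteq> Y"
  using assms Un_subset_internal_coproduct[OF fully_invariantD(1)]
  by (fastforce simp: Spec_fc_def fully_coprime_def)

lemma X_fc_internal_coproduct:
  assumes "fully_invariant R M X" "fully_invariant R M Y"
  shows "X_fc R M (internal_coproduct R M X Y) = X_fc R M X \<inter> X_fc R M Y"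
  unfolding X_fc_def using coprime_subset_internal_coproduct_iff[OF _ assms] by blast

lemma V_fc_internal_coproduct:
  assumes "fully_invariant R M X" "fully_invariant R M Y"
  shows "V_fc R M (internal_coproduct R M X Y) = V_fc R M X \<union> V_fc R M Y"
  unfolding V_fc_def using coprime_subset_internal_coproduct_iff[OF _ assms] by blast

lemma Spec_fc_subset_carrier: "K \<in> Spec_fc R M \<Longrightarrow> K \<subseteq> carrier M"
  using submoduleD(1)[OF fully_invariantD(1)] by (auto simp: Spec_fc_def fully_coprime_def)

lemma X_fc_zero: "X_fc R M {\<zero>\<^bsub>M\<^esub>} = Spec_fc R M"
  using submoduleD(2)[OF fully_invariantD(1)]
  by (auto simp: X_fc_def Spec_fc_def fully_coprime_def)

lemma topology_on_set_tau_fc_fi: "topology_on_set (Spec_fc R M) (tau_fc_fi R M)"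
proof -
  have "S \<inter> T \<in> tau_fc_fi R M" if "S \<in> tau_fc_fi R M" "T \<in> tau_fc_fi R M" for S T
  proof -
    obtain X Y where XY: "fully_invariant R M X" "fully_invariant R M Y"
      and "S = X_fc R M X" "T = X_fc R M Y"
      using \<open>S \<in> tau_fc_fi R M\<close> \<open>T \<in> tau_fc_fi R M\<close> by (auto simp: tau_fc_fi_def)
    then have "S \<inter> T = X_fc R M (internal_coproduct R M X Y)"
      by (simp add: X_fc_internal_coproduct)
    then show ?thesis
      using fully_invariant_internal_coproduct[OF XY(1) fully_invariantD(1)[OF XY(2)]]
      by (auto simp: tau_fc_fi_def)
  qed
  moreover have "\<Union>\<K> \<in> tau_fc_fi R M" if \<K>: "\<forall>S \<in> \<K>. S \<in> tau_fc_fi R M" for \<K>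
  proof -
    \<comment> \<open>All submodules presenting a member of the family are taken, which avoids choosing one
        for each member.\<close>
    define \<A> where "\<A> = {L. fully_invariant R M L \<and> X_fc R M L \<in> \<K>}"
    have "\<K> = X_fc R M ` \<A>"
      using \<K> by (fastforce simp: \<A>_def tau_fc_fi_def)
    then have "\<Union>\<K> = X_fc R M (carrier M \<inter> \<Inter>\<A>)"
      using Spec_fc_subset_carrier by (auto simp: X_fc_def)
    moreover have "fully_invariant R M (carrier M \<inter> \<Inter>\<A>)"
      by (rule fully_invariant_Inter) (simp add: \<A>_def)
    ultimately show ?thesis by (auto simp: tau_fc_fi_def)
  qed
  ultimately have top: "istopology (\<lambda>U. U \<in> tau_fc_fi R M)"
    by (simp add: istopology_def)
  have "\<Union>(tau_fc_fi R M) = Spec_fc R M"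
  proof
    show "\<Union>(tau_fc_fi R M) \<subseteq> Spec_fc R M" by (auto simp: tau_fc_fi_def X_fc_def)
    show "Spec_fc R M \<subseteq> \<Union>(tau_fc_fi R M)"
      using X_fc_zero fully_invariant_zero by (auto simp: tau_fc_fi_def)
  qed
  then show ?thesis
    using top by (simp add: topology_on_set_def topspace_def topology_inverse')
qed

section \<open>Duo modules\<close>

lemma duo_module_submodule_iff:
  assumes "duo_module R M"
  shows "submodule L R M \<longleftrightarrow> fully_invariant R M L"
  using assms fully_invariantD(1) by (auto simp: duo_module_def)

lemma duo_module_tau_fc: "duo_module R M \<Longrightarrow> tau_fc R M = tau_fc_fi R M"
  by (simp add: tau_fc_def tau_fc_fi_def duo_module_submodule_iff)

text \<open>
  As every submodule is fully invariant, the internal coproduct presents the union of any two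
  members; the empty union is \<open>V_fc\<close> of the zero submodule, since coprime submodules are non-zero.
\<close>

lemma duo_module_top_fc:
  assumes duo: "duo_module R M"
  shows "top_fc_module R M"
  unfolding top_fc_module_def
proof (intro allI impI)
  have xi: "xi_fc R M = {V_fc R M L | L. fully_invariant R M L}"
    by (simp add: xi_fc_def duo_module_submodule_iff[OF duo])
  fix F assume "finite F" "F \<subseteq> xi_fc R M"
  then show "\<Union>F \<in> xi_fc R M"
  proof (induction F rule: finite_induct)
    case empty
    have "V_fc R M {\<zero>\<^bsub>M\<^esub>} = {}" using X_fc_zero by (auto simp: V_fc_def X_fc_def)
    then show ?case using fully_invariant_zero by (auto simp: xi)
  next
    case (insert S F)
    then obtain X Y where XY: "fully_invariant R M X" "fully_invariant R M Y"
      and "S = V_fc R M X" "\<Union>F = V_fc R M Y"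
      by (auto simp: xi)
    then have "\<Union>(insert S F) = V_fc R M (internal_coproduct R M X Y)"
      by (simp add: V_fc_internal_coproduct)
    then show ?case
      using fully_invariant_internal_coproduct[OF XY(1) fully_invariantD(1)[OF XY(2)]]
      by (auto simp: xi)
  qed
qed

end

theorem theorem3p20:
  fixes R :: "('a, 'r) ring_scheme" and M :: "('a, 'b, 'm) module_scheme"
  assumes "left_module R M"
    and "\<one>\<^bsub>R\<^esub> \<noteq> \<zero>\<^bsub>R\<^esub>"
    and "carrier M \<noteq> {\<zero>\<^bsub>M\<^esub>}"
  shows "topology_on_set (Spec_fc R M) (tau_fc_fi R M) \<and>
    (duo_module R M \<longrightarrow>
      top_fc_module R M \<and> topology_on_set (Spec_fc R M) (tau_fc R M))"
proof -
  interpret left_module R M by fact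
  show ?thesis
    using topology_on_set_tau_fc_fi duo_module_top_fc duo_module_tau_fc by simp
qed

end
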